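(* Let $\mathbb{F}$ be a field, let $W(t)=\sum_{n=0}^{\infty}\frac{t^n}{w_n}\in\mathbb{F}[[t]]$ with $w_0=1$ and $w_n\neq0$ for all $n$, let $\{p_n(x)\}_{n\in\mathbb{N}}$ be a graded sequence of polynomials in $\mathbb{F}[x]$, and let $A\in L$ be its associated matrix. Then $\{p_n(x)\}_{n\in\mathbb{N}}$ is a $W$-Sheffer sequence if and only if $A\in R_W$.
   Context: $\mathbb{N}=\{0,1,2,\dots\}$. A sequence of polynomials $\{p_n\}_{n\in\mathbb{N}}$ in $\mathbb{F}[x]$ is graded if $\deg p_n=n$ for all $n$. $L$ is the group, under matrix multiplication, of infinite lower triangular matrices $(a_{n,k})_{n,k\in\mathbb{N}}$ over $\mathbb{F}$ with non-zero diagonal entries; the matrix $A\in L$ associated with a graded sequence is determined by $p_n(x)=\sum_{k=0}^n a_{n,k}x^k$. For $h\in\mathbb{F}$ the $W$-translation $T_{h,W}$ is the linear operator on $\mathbb{F}[x]$ taking $\frac{x^n}{w_n}$ to $\sum_{k=0}^n\frac{h^{n-k}}{w_{n-k}}\cdot\frac{x^k}{w_k}$. For a graded sequence $\{p_n\}$, $Q_{A,W}$ is the linear operator on $\mathbb{F}[x]$ sending $\frac{p_n}{w_n}$ to $\frac{p_{n-1}}{w_{n-1}}$ for $n\geq1$ and $p_0$ to $0$. The graded sequence is called $W$-Sheffer if $Q_{A,W}$ commutes with $T_{h,W}$ for all $h\in\mathbb{F}$. $R_W$ is the set of $W$-Riordan arrays: those $A\in L$ such that, with $C_k(y)=\sum_{n=0}^\infty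 a_{n,k}\frac{y^n}{w_n}\in\mathbb{F}[[y]]$ (of valuation $k$), the quotient $\frac{w_{k+1}C_{k+1}}{w_kC_k}$ is independent of $k$. *)

theory Defs
  imports "HOL-Computational_Algebra.Computational_Algebra"
begin

text \<open>
  The series \<open>W(t) = (\<Sum>n. t^n / w n)\<close> is represented by the sequence \<open>w\<close> of the denominators of its
  coefficients.  Operators given by their values on a basis of \<open>F[x]\<close> are defined by definite
  description; the lemmas \<open>W_translation_spec\<close> and \<open>Q_operator_spec\<close> show that these descriptions
  are satisfied.
\<close>

abbreviation linear_operator :: "('a::field poly \<Rightarrow> 'a poly) \<Rightarrow> bool" where
  "linear_operator \<equiv> Vector_Spaces.linear smult smult"

definition graded :: "(nat \<Rightarrow> 'a::field poly) \<Rightarrow> bool" where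
  "graded p \<longleftrightarrow> (\<forall>n. p n \<noteq> 0 \<and> degree (p n) = n)"

definition lower_triangular_group :: "(nat \<Rightarrow> nat \<Rightarrow> 'a::field) set" where
  "lower_triangular_group = {A. (\<forall>n k. n < k \<longrightarrow> A n k = 0) \<and> (\<forall>n. A n n \<noteq> 0)}"

definition W_translation_cond ::
    "(nat \<Rightarrow> 'a::field) \<Rightarrow> 'a \<Rightarrow> ('a poly \<Rightarrow> 'a poly) \<Rightarrow> bool" where
  "W_translation_cond w h T \<longleftrightarrow> linear_operator T \<and>
     (\<forall>n. T (smult (1 / w n) (monom 1 n)) =
        (\<Sum>k\<le>n. smult (h ^ (n - k) / w (n - k)) (smult (1 / w k) (monom 1 k))))"

definition W_translation :: "(nat \<Rightarrow> 'a::field) \<Rightarrow> 'a \<Rightarrow> 'a poly \<Rightarrow> 'a poly" where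
  "W_translation w h = (THE T. W_translation_cond w h T)"

definition Q_operator_cond ::
    "(nat \<Rightarrow> 'a::field) \<Rightarrow> (nat \<Rightarrow> 'a poly) \<Rightarrow> ('a poly \<Rightarrow> 'a poly) \<Rightarrow> bool" where
  "Q_operator_cond w p Q \<longleftrightarrow> linear_operator Q \<and> Q (p 0) = 0 \<and>
     (\<forall>n\<ge>1. Q (smult (1 / w n) (p n)) = smult (1 / w (n - 1)) (p (n - 1)))"

definition Q_operator :: "(nat \<Rightarrow> 'a::field) \<Rightarrow> (nat \<Rightarrow> 'a poly) \<Rightarrow> 'a poly \<Rightarrow> 'a poly" where
  "Q_operator w p = (THE Q. Q_operator_cond w p Q)"

definition W_Sheffer :: "(nat \<Rightarrow> 'a::field) \<Rightarrow> (nat \<Rightarrow> 'a poly) \<Rightarrow> bool" where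
  "W_Sheffer w p \<longleftrightarrow> graded p \<and>
     (\<forall>h. Q_operator w p \<circ> W_translation w h = W_translation w h \<circ> Q_operator w p)"

definition column_series ::
    "(nat \<Rightarrow> 'a::field) \<Rightarrow> (nat \<Rightarrow> nat \<Rightarrow> 'a) \<Rightarrow> nat \<Rightarrow> 'a fps" where
  "column_series w A k = Abs_fps (\<lambda>n. A n k / w n)"

text \<open>
  For \<open>A\<close> in \<open>lower_triangular_group\<close> the \<open>k\<close>-th column series has valuation exactly \<open>k\<close>
  (\<open>subdegree_column_series\<close>), so the division of formal power series below is exact.
\<close>

definition W_Riordan :: "(nat \<Rightarrow> 'a::field) \<Rightarrow> (nat \<Rightarrow> nat \<Rightarrow> 'a) set" where
  "W_Riordan w = {A \<in> lower_triangular_group. \<exists>f. \<forall>k.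
     (fps_const (w (Suc k)) * column_series w A (Suc k)) div
       (fps_const (w k) * column_series w A k) = f}"

lemma subdegree_column_series:
  assumes "A \<in> lower_triangular_group" "\<And>n. w n \<noteq> 0"
  shows "subdegree (column_series w A k) = k"
  using assms by (intro subdegreeI) (auto simp: column_series_def lower_triangular_group_def)

lemma vector_space_smult: "vector_space (smult :: 'a::field \<Rightarrow> 'a poly \<Rightarrow> 'a poly)"
  by standard (auto simp: smult_add_left smult_add_right)

lemma graded_coeff:
  assumes "graded q"
  shows "coeff (q n) n \<noteq> 0" and "n < k \<Longrightarrow> coeff (q n) k = 0"
proof -
  from assms have q: "q n \<noteq> 0" "degree (q n) = n" by (auto simp: graded_def)
  show "coeff (q n) n \<noteq> 0" using q leading_coeff_neq_0[of "q n"] by simp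
  show "coeff (q n) k = 0" if "n < k" using q that by (simp add: coeff_eq_0)
qed

lemma ex1_linear_operator_graded:
  fixes q g :: "nat \<Rightarrow> 'a::field poly"
  assumes q: "graded q"
  shows "\<exists>!L. linear_operator L \<and> (\<forall>n. L (q n) = g n)"
proof -
  interpret V: vector_space "smult :: 'a \<Rightarrow> 'a poly \<Rightarrow> 'a poly" by (rule vector_space_smult)
  interpret P: vector_space_pair "smult :: 'a \<Rightarrow> 'a poly \<Rightarrow> 'a poly" "smult :: 'a \<Rightarrow> 'a poly \<Rightarrow> 'a poly" ..
  have deg: "degree (q n) = n" for n using q by (simp add: graded_def)
  have inj: "inj q" by (metis deg injI)
  have ind: "V.independent (range q)"
    unfolding V.independent_explicit_finite_subsets
  proof (intro allI impI ballI)
    fix S u v assume S: "S \<subseteq> range q" "finite S" and sum: "(\<Sum>v\<in>S. smult (u v) v) = 0" and v: "v \<in> S"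
    show "u v = 0"
    proof (rule ccontr)
      assume nz: "u v \<noteq> 0"
      define N where "N = {n. q n \<in> S \<and> u (q n) \<noteq> 0}"
      have fN: "finite N"
        by (rule finite_subset[of _ "q -` S"]) (auto simp: N_def intro!: finite_vimageI S inj)
      have ne: "N \<noteq> {}" using S(1) v nz by (auto simp: N_def)
      define m where "m = Max N"
      have m: "m \<in> N" using fN ne by (simp add: m_def)
      have "0 = coeff (\<Sum>v\<in>S. smult (u v) v) m" using sum by simp
      also have "\<dots> = (\<Sum>v\<in>S. u v * coeff v m)" by (simp add: coeff_sum)
      also have "\<dots> = (\<Sum>v\<in>S. if v = q m then u v * coeff v m else 0)"
      proof (rule sum.cong[OF refl])
        fix v assume vS: "v \<in> S"
        then obtain n where n: "v = q n" using S(1) by auto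
        show "u v * coeff v m = (if v = q m then u v * coeff v m else 0)"
        proof (cases "u v = 0 \<or> v = q m")
          case False
          hence "n \<in> N" "n \<noteq> m" using vS n by (auto simp: N_def)
          hence "n < m" using fN by (simp add: m_def order_less_le)
          hence "coeff v m = 0" using n graded_coeff(2)[OF q, of n m] by simp
          thus ?thesis by (simp only: mult_zero_right if_cancel)
        qed auto
      qed
      also have "\<dots> = u (q m) * coeff (q m) m" using m S(2) by (simp add: N_def)
      also have "\<dots> \<noteq> 0" using m graded_coeff(1)[OF q] by (simp add: N_def)
      finally show False by simp
    qed
  qed
  have span0: "f \<in> V.span (range q)" if "\<And>k. n \<le> k \<Longrightarrow> coeff f k = 0" for f n
    using that
  proof (induction n arbitrary: f)
    case 0
    hence "f = 0" by (intro poly_eqI) simp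
    thus ?case by (simp add: V.span_zero)
  next
    case (Suc n)
    define c where "c = coeff f n / coeff (q n) n"
    have "f - smult c (q n) \<in> V.span (range q)"
    proof (rule Suc.IH)
      fix k assume "n \<le> k"
      thus "coeff (f - smult c (q n)) k = 0"
        using Suc.prems[of k] graded_coeff[OF q, of n]
        by (cases "k = n") (auto simp: c_def)
    qed
    moreover have "smult c (q n) \<in> V.span (range q)"
      by (intro V.span_scale V.span_base) simp
    ultimately have "(f - smult c (q n)) + smult c (q n) \<in> V.span (range q)"
      by (rule V.span_add)
    thus ?case by simp
  qed
  have span: "f \<in> V.span (range q)" for f
    by (rule span0[of "Suc (degree f)"]) (simp add: coeff_eq_0)
  show ?thesis
  proof (rule ex_ex1I)
    obtain L where L: "linear_operator L" "\<forall>x\<in>range q. L x = g (inv q x)"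
      using P.linear_independent_extend[OF ind, of "\<lambda>x. g (inv q x)"] by blast
    have "L (q n) = g n" for n
      using bspec[OF L(2) rangeI, of n] by (simp only: inv_f_f[OF inj])
    with L(1) show "\<exists>L. linear_operator L \<and> (\<forall>n. L (q n) = g n)" by blast
  next
    fix L M
    assume L: "linear_operator L \<and> (\<forall>n. L (q n) = g n)"
      and M: "linear_operator M \<and> (\<forall>n. M (q n) = g n)"
    show "L = M"
    proof (rule ext)
      fix f
      show "L f = M f"
      proof (rule P.linear_eq_on[OF conjunct1[OF L] conjunct1[OF M] span[of f]])
        fix b assume "b \<in> range q"
        then obtain n where "b = q n" by blast
        thus "L b = M b" using conjunct2[OF L] conjunct2[OF M] by (simp only:)
      qed
    qed
  qed
qed

lemma graded_smult:
  assumes "graded p" "\<And>n. w n \<noteq> 0"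
  shows "graded (\<lambda>n. smult (1 / w n) (p n))"
  using assms by (auto simp: graded_def)

lemma W_translation_spec:
  fixes w :: "nat \<Rightarrow> 'a::field"
  assumes "\<And>n. w n \<noteq> 0"
  shows "W_translation_cond w h (W_translation w h)"
  unfolding W_translation_def
proof (rule theI'[of "W_translation_cond w h"])
  have "graded (\<lambda>n. monom (1::'a) n)"
    by (auto simp: graded_def degree_monom_eq)
  from ex1_linear_operator_graded[OF graded_smult[of _ w, OF this assms]]
  show "\<exists>!T. W_translation_cond w h T"
    unfolding W_translation_cond_def .
qed

lemma Q_operator_spec:
  fixes w :: "nat \<Rightarrow> 'a::field"
  assumes "graded p" "\<And>n. w n \<noteq> 0"
  shows "Q_operator_cond w p (Q_operator w p)"
  unfolding Q_operator_def
proof (rule theI'[of "Q_operator_cond w p"])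
  let ?q = "\<lambda>n. smult (1 / w n) (p n)"
  let ?g = "\<lambda>n::nat. if n = 0 then 0 else ?q (n - 1)"
  have "Q_operator_cond w p L \<longleftrightarrow> linear_operator L \<and> (\<forall>n. L (?q n) = ?g n)" for L
  proof (cases "linear_operator L")
    case True
    have "L (?q 0) = smult (1 / w 0) (L (p 0))"
      by (rule module_hom.scale) (use True in \<open>simp add: module_hom_iff_linear\<close>)
    hence "L (p 0) = 0 \<longleftrightarrow> L (?q 0) = 0" using assms(2)[of 0] by simp
    moreover have "(\<forall>n. L (?q n) = ?g n) \<longleftrightarrow> L (?q 0) = 0 \<and> (\<forall>n\<ge>1. L (?q n) = ?q (n - 1))"
      (is "(\<forall>n. ?P n) \<longleftrightarrow> ?R")
    proof (intro iffI allI)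
      fix n assume r: ?R
      show "?P n"
      proof (cases "n = 0")
        case True
        show ?thesis unfolding True using conjunct1[OF r] by (simp only: if_True simp_thms)
      next
        case False
        hence "1 \<le> n" by simp
        with conjunct2[OF r] have "L (?q n) = ?q (n - 1)" by blast
        with False show ?thesis by (simp only: if_False)
      qed
    next
      assume P: "\<forall>n. ?P n"
      show ?R
      proof (intro conjI allI impI)
        show "L (?q 0) = 0" using P[rule_format, of 0] by (simp only: if_True simp_thms)
        fix n :: nat assume "1 \<le> n"
        hence "n \<noteq> 0" by simp
        thus "L (?q n) = ?q (n - 1)" using P[rule_format, of n] by (simp only: if_False)
      qed
    qed
    ultimately show ?thesis unfolding Q_operator_cond_def by (simp only: True simp_thms)
  qed (simp add: Q_operator_cond_def)
  hence "Q_operator_cond w p = (\<lambda>L. linear_operator L \<and> (\<forall>n. L (?q n) = ?g n))"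
    by (rule ext)
  thus "\<exists>!L. Q_operator_cond w p L"
    using ex1_linear_operator_graded[OF graded_smult[of p w, OF assms], where g = ?g] by (simp only:)
qed

end

theory Submission
  imports Defs
begin

text \<open>
  Let \<open>D\<close> be the operator \<open>x^n / w n \<mapsto> x^(n-1) / w (n-1)\<close>, which plays the role of the derivative
  (\<open>W_derivative\<close>), and let \<open>Q\<close> be the operator lowering the polynomials \<open>q n = p n / w n\<close>.  Both
  sides of the equivalence say that \<open>Q\<close> and \<open>D\<close> commute.

  For the Sheffer side, note that the translation \<open>T_h\<close> is the series \<open>W(h D)\<close> in \<open>D\<close>, so that it
  commutes with \<open>D\<close>.  Conversely, \<open>h = 1\<close> alone suffices to recover \<open>D\<close>, over every field:
  \<open>U = T_1 - I\<close> lowers all degrees by exactly one, as \<open>1 / w 1 \<noteq> 0\<close>.  The decisive fact is that the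
  centralizer of such a degree-lowering operator is commutative
  (\<open>centralizer_delta_operator_commutative\<close>).  If \<open>Q\<close> commutes with \<open>T_1\<close>, then \<open>Q\<close> and \<open>D\<close> both
  lie in the centralizer of \<open>U\<close>; if \<open>Q\<close> commutes with \<open>D\<close>, then \<open>Q\<close> and every \<open>T_h\<close> lie in the
  centralizer of \<open>D\<close>.

  For the Riordan side, an operator \<open>L\<close> commutes with \<open>Q\<close> if and only if it is a power series in
  \<open>Q\<close>, which means that \<open>L (q n) = (\<Sum>i\<le>n. f i * q (n - i))\<close> for a fixed sequence \<open>f\<close>
  (\<open>commutes_iff_convolution\<close>).  For \<open>L = D\<close>, the coefficients of \<open>x^k\<close> in this equation say that
  \<open>w (k+1) * C (k+1) = f * (w k * C k)\<close> for the column series \<open>C k\<close>, with the same power series \<open>f\<close>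
  for all \<open>k\<close>; this is the Riordan condition.
\<close>

section \<open>Linear operators on polynomials\<close>

lemma linear_operatorI:
  assumes "\<And>u v. L (u + v) = L u + L v" "\<And>c u. L (smult c u) = smult c (L u)"
  shows "linear_operator (L :: 'a::field poly \<Rightarrow> 'a poly)"
  using assms vector_space_smult by (auto intro!: Vector_Spaces.linear.intro module_hom.intro
      module_hom_axioms.intro simp: vector_space_def module_def)

lemma linear_operator_simps:
  assumes "linear_operator (L :: 'a::field poly \<Rightarrow> 'a poly)"
  shows "L 0 = 0" "L (u + v) = L u + L v" "L (u - v) = L u - L v"
    "L (smult c u) = smult c (L u)" "L (sum g S) = (\<Sum>i\<in>S. L (g i))"
proof -
  have "module_hom smult smult L"
    using assms by (simp add: module_hom_iff_linear)
  from module_hom.zero[OF this] module_hom.add[OF this] module_hom.diff[OF this]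
    module_hom.scale[OF this] module_hom.sum[OF this]
  show "L 0 = 0" "L (u + v) = L u + L v" "L (u - v) = L u - L v"
    "L (smult c u) = smult c (L u)" "L (sum g S) = (\<Sum>i\<in>S. L (g i))" by blast+
qed

lemma linear_operator_comp:
  assumes "linear_operator L" "linear_operator M"
  shows "linear_operator (L \<circ> M :: 'a::field poly \<Rightarrow> 'a poly)"
  by (rule linear_operatorI)
    (simp_all add: linear_operator_simps[OF assms(1)] linear_operator_simps[OF assms(2)])

lemma linear_operator_eqI:
  fixes L M :: "'a::field poly \<Rightarrow> 'a poly"
  assumes "linear_operator L" "linear_operator M" "graded q" "\<And>n. L (q n) = M (q n)"
  shows "L = M"
  using ex1_linear_operator_graded[OF assms(3), of "\<lambda>n. M (q n)"] assms by blast

section \<open>Delta operators and their centralizers\<close>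

text \<open>
  These are the operators that behave like the derivative in characteristic zero.  Since \<open>degree 0\<close>
  is \<open>0\<close> and subtraction is truncated, the kernel consists of the constants, the zero polynomial
  included, and the degree condition is consistent with this.
\<close>
definition delta_operator :: "('a::field poly \<Rightarrow> 'a poly) \<Rightarrow> bool" where
  "delta_operator P \<longleftrightarrow> linear_operator P \<and> (\<forall>u. P u = 0 \<longleftrightarrow> degree u = 0) \<and>
     (\<forall>u. degree (P u) = degree u - 1)"

text \<open>
  A polynomial of degree \<open>n + 1\<close> is a nonzero multiple of \<open>q (n + 1)\<close> plus a polynomial of smaller
  degree, so its image has the same leading term as that of the multiple of \<open>q (n + 1)\<close>.
\<close>
lemma delta_operatorI_graded:
  fixes P :: "'a::field poly \<Rightarrow> 'a poly"
  assumes lin: "linear_operator P" and q: "graded q"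
    and zero: "P (q 0) = 0" and image: "graded (\<lambda>n. P (q (Suc n)))"
  shows "delta_operator P"
proof -
  have "(P u = 0 \<longleftrightarrow> degree u = 0) \<and> degree (P u) = degree u - 1" if "degree u \<le> n" for u n
    using that
  proof (induction n arbitrary: u)
    case 0
    define c where "c = coeff u 0 / coeff (q 0) 0"
    have "u = smult c (q 0)"
    proof (rule poly_eqI)
      fix k show "coeff u k = coeff (smult c (q 0)) k"
        using 0 graded_coeff[OF q, of 0] by (cases "k = 0") (auto simp: c_def coeff_eq_0)
    qed
    hence "P u = 0" by (simp add: linear_operator_simps[OF lin] zero)
    with 0 show ?case by simp
  next
    case (Suc n)
    show ?case
    proof (cases "degree u \<le> n")
      case True
      thus ?thesis by (rule Suc.IH)
    next
      case False
      with Suc.prems have deg: "degree u = Suc n" by simp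
      define c where "c = coeff u (Suc n) / coeff (q (Suc n)) (Suc n)"
      define v where "v = u - smult c (q (Suc n))"
      have c: "c \<noteq> 0"
        using deg graded_coeff(1)[OF q, of "Suc n"] leading_coeff_neq_0[of u]
        by (cases "u = 0") (auto simp: c_def)
      have "degree v \<le> n"
      proof (rule degree_le, intro allI impI)
        fix k assume "n < k"
        thus "coeff v k = 0"
          using Suc.prems graded_coeff[OF q, of "Suc n"]
          by (cases "k = Suc n") (auto simp: v_def c_def coeff_eq_0)
      qed
      from Suc.IH[OF this] have v: "P v = 0 \<longleftrightarrow> degree v = 0" "degree (P v) = degree v - 1"
        by auto
      have Pu: "P u = smult c (P (q (Suc n))) + P v"
        by (simp add: v_def linear_operator_simps[OF lin])
      have Pq: "P (q (Suc n)) \<noteq> 0" "degree (P (q (Suc n))) = n"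
        using image by (auto simp: graded_def)
      have "P v = 0 \<or> degree (P v) < n"
        using v \<open>degree v \<le> n\<close> by (cases "degree v = 0") auto
      hence "P u \<noteq> 0 \<and> degree (P u) = n"
      proof
        assume "P v = 0"
        thus ?thesis using Pu Pq c by simp
      next
        assume *: "degree (P v) < n"
        have "degree (P u) = n"
          unfolding Pu using degree_add_eq_left[of "P v" "smult c (P (q (Suc n)))"] * Pq c by simp
        thus ?thesis using * by auto
      qed
      thus ?thesis using deg by simp
    qed
  qed
  thus ?thesis unfolding delta_operator_def using lin by blast
qed

text \<open>
  The images of the nonconstant monomials have every degree exactly once; subtracting
  multiples of them removes the leading terms of \<open>v\<close> one after the other.
\<close>
lemma delta_operator_surj:
  fixes P :: "'a::field poly \<Rightarrow> 'a poly"
  assumes P: "delta_operator P"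
  shows "\<exists>u. P u = v"
proof -
  have lin: "linear_operator P" and ker: "\<And>u. P u = 0 \<longleftrightarrow> degree u = 0"
    and deg: "\<And>u. degree (P u) = degree u - 1"
    using P by (auto simp: delta_operator_def)
  have "\<exists>u. P u = v" if "\<And>k. n \<le> k \<Longrightarrow> coeff v k = 0" for n
    using that
  proof (induction n arbitrary: v)
    case 0
    hence "v = 0" by (intro poly_eqI) simp
    thus ?case using linear_operator_simps(1)[OF lin] by blast
  next
    case (Suc n)
    define m where "m = P (monom 1 (Suc n))"
    have m: "m \<noteq> 0" "degree m = n"
      using ker[of "monom 1 (Suc n)"] deg[of "monom 1 (Suc n)"]
      by (auto simp: m_def degree_monom_eq)
    have mn: "coeff m n \<noteq> 0" using m leading_coeff_neq_0[of m] by simp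
    define c where "c = coeff v n / coeff m n"
    have "\<exists>u. P u = v - smult c m"
    proof (rule Suc.IH)
      fix k assume "n \<le> k"
      thus "coeff (v - smult c m) k = 0"
        using Suc.prems[of k] m mn
        by (cases "k = n") (auto simp: c_def coeff_eq_0)
    qed
    then obtain u where "P u = v - smult c m" by blast
    hence "P (u + smult c (monom 1 (Suc n))) = v"
      by (simp add: linear_operator_simps(2)[OF lin] linear_operator_simps(4)[OF lin] m_def
          del: smult_monom)
    thus ?case by blast
  qed
  from this[of "Suc (degree v)"] show ?thesis by (simp add: coeff_eq_0)
qed

text \<open>
  Iterating a right inverse of \<open>P\<close> on the constant \<open>1\<close> gives a graded sequence shifted by \<open>P\<close>, as
  \<open>x^n / n!\<close> is for the derivative.
\<close>
lemma delta_operator_basic_sequence: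
  fixes P :: "'a::field poly \<Rightarrow> 'a poly"
  assumes P: "delta_operator P"
  obtains q where "graded q" "P (q 0) = 0" "\<And>n. P (q (Suc n)) = q n"
proof -
  define R where "R v = (SOME u. P u = v)" for v
  have R: "P (R v) = v" for v
    unfolding R_def using delta_operator_surj[OF P, of v] by (rule someI_ex)
  define q where "q n = (R ^^ n) 1" for n
  have step: "P (q (Suc n)) = q n" for n by (simp add: q_def R)
  have "q n \<noteq> 0 \<and> degree (q n) = n" for n
  proof (induction n)
    case 0 thus ?case by (simp add: q_def)
  next
    case (Suc n)
    hence "P (q (Suc n)) \<noteq> 0" "degree (P (q (Suc n))) = n" by (simp_all add: step)
    moreover have "degree (q (Suc n)) \<noteq> 0" "degree (P (q (Suc n))) = degree (q (Suc n)) - 1"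
      using calculation(1) P by (auto simp: delta_operator_def)
    ultimately show ?case by auto
  qed
  hence "graded q" by (simp add: graded_def)
  moreover have "P (q 0) = 0" using P by (simp add: delta_operator_def q_def)
  ultimately show thesis using step that by blast
qed

text \<open>
  The right-hand side says that \<open>L\<close> is the power series \<open>f\<close> in \<open>P\<close>.  To find \<open>f\<close>, it is enough to
  look at constant terms: they force \<open>f * (\<Sum>n. q n(0) y^n) = (\<Sum>n. L (q n)(0) y^n)\<close>, which is
  solvable because \<open>q 0\<close> is a nonzero constant.  With this \<open>f\<close>, the two sides for \<open>q (n + 1)\<close> have
  the same image under \<open>P\<close> by induction, hence differ by a constant, and that constant is zero.
\<close>
lemma commutes_iff_convolution:
  fixes P L :: "'a::field poly \<Rightarrow> 'a poly"
  assumes P: "delta_operator P" and L: "linear_operator L"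
    and q: "graded q" "P (q 0) = 0" "\<And>n. P (q (Suc n)) = q n"
  shows "P \<circ> L = L \<circ> P \<longleftrightarrow>
    (\<exists>f :: 'a fps. \<forall>n. L (q n) = (\<Sum>i\<le>n. smult (f $ i) (q (n - i))))"
proof -
  have lin: "linear_operator P" and ker: "\<And>u. P u = 0 \<longleftrightarrow> degree u = 0"
    using P by (auto simp: delta_operator_def)
  define conv where "conv f n = (\<Sum>i\<le>n. smult (f $ i) (q (n - i)))" for f :: "'a fps" and n
  have P_conv: "P (conv f 0) = 0" "P (conv f (Suc n)) = conv f n" for f n
  proof -
    show "P (conv f 0) = 0"
      by (simp add: conv_def linear_operator_simps[OF lin] q)
    have "P (conv f (Suc n)) = (\<Sum>i\<le>n. smult (f $ i) (P (q (Suc (n - i)))))"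
      by (simp add: conv_def linear_operator_simps[OF lin] q(2) Suc_diff_le)
    thus "P (conv f (Suc n)) = conv f n"
      by (simp add: conv_def q(3))
  qed
  have "P \<circ> L = L \<circ> P \<longleftrightarrow> (\<exists>f. \<forall>n. L (q n) = conv f n)"
  proof
    assume comm: "P \<circ> L = L \<circ> P"
    define F where "F = Abs_fps (\<lambda>n. coeff (q n) 0)"
    define G where "G = Abs_fps (\<lambda>n. coeff (L (q n)) 0)"
    define f where "f = G * inverse F"
    have "F $ 0 \<noteq> 0" using graded_coeff(1)[OF q(1), of 0] by (simp add: F_def)
    hence fF: "f * F = G" by (simp add: f_def mult.assoc inverse_mult_eq_1)
    have const: "coeff (conv f n) 0 = coeff (L (q n)) 0" for n
    proof -
      have "coeff (conv f n) 0 = (f * F) $ n"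
        by (simp add: conv_def coeff_sum fps_mult_nth F_def atLeast0AtMost)
      thus ?thesis by (simp add: fF G_def)
    qed
    have PL: "P (L u) = L (P u)" for u using comm by (metis comp_apply)
    have eqI: "L (q n) = conv f n" if "P (L (q n) - conv f n) = 0" for n
    proof -
      from that ker obtain a where a: "L (q n) - conv f n = [:a:]"
        by (metis degree_eq_zeroE)
      have "a = 0" using arg_cong[OF a, of "\<lambda>u. coeff u 0"] const[of n] by simp
      with a show ?thesis by simp
    qed
    have "L (q n) = conv f n" for n
    proof (induction n)
      case 0
      show ?case
        by (rule eqI) (simp add: linear_operator_simps[OF lin] PL q(2) P_conv
            linear_operator_simps(1)[OF L])
    next
      case (Suc n)
      show ?case
        by (rule eqI) (simp add: linear_operator_simps[OF lin] PL q(3) P_conv Suc)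
    qed
    thus "\<exists>f. \<forall>n. L (q n) = conv f n" by blast
  next
    assume "\<exists>f. \<forall>n. L (q n) = conv f n"
    then obtain f where f: "\<And>n. L (q n) = conv f n" by blast
    show "P \<circ> L = L \<circ> P"
    proof (rule linear_operator_eqI[OF linear_operator_comp[OF lin L] linear_operator_comp[OF L lin] q(1)])
      fix n show "(P \<circ> L) (q n) = (L \<circ> P) (q n)"
        by (cases n) (simp_all add: f P_conv q(2,3) linear_operator_simps(1)[OF L])
    qed
  qed
  thus ?thesis by (simp add: conv_def)
qed

lemma smult_sum_right: "smult (c :: 'a::comm_semiring_0) (sum g S) = (\<Sum>i\<in>S. smult c (g i))"
  by (induction S rule: infinite_finite_induct) (simp_all add: smult_add_right)

text \<open>
  On a sequence shifted by \<open>P\<close>, both operators act by convolution with a power series, and the product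
  of power series is commutative.
\<close>
lemma centralizer_delta_operator_commutative:
  fixes P L M :: "'a::field poly \<Rightarrow> 'a poly"
  assumes P: "delta_operator P" and L: "linear_operator L" and M: "linear_operator M"
    and PL: "P \<circ> L = L \<circ> P" and PM: "P \<circ> M = M \<circ> P"
  shows "L \<circ> M = M \<circ> L"
proof -
  obtain q where q: "graded q" "P (q 0) = 0" "\<And>n. P (q (Suc n)) = q n"
    using delta_operator_basic_sequence[OF P] by metis
  obtain f :: "'a fps" where f: "\<And>n. L (q n) = (\<Sum>i\<le>n. smult (f $ i) (q (n - i)))"
    using commutes_iff_convolution[OF P L q] PL by blast
  obtain g :: "'a fps" where g: "\<And>n. M (q n) = (\<Sum>i\<le>n. smult (g $ i) (q (n - i)))"
    using commutes_iff_convolution[OF P M q] PM by blast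
  show ?thesis
  proof (rule linear_operator_eqI[OF linear_operator_comp[OF L M] linear_operator_comp[OF M L] q(1)])
    fix n
    have "L (M (q n)) = (\<Sum>i\<le>n. \<Sum>j\<le>n - i. smult (g $ i * f $ j) (q (n - i - j)))"
      by (simp add: g linear_operator_simps[OF L] f smult_sum_right)
    also have "\<dots> = (\<Sum>i\<le>n. \<Sum>j\<in>{j \<in> {..n}. i + j \<le> n}. smult (g $ i * f $ j) (q (n - i - j)))"
      by (intro sum.cong refl) auto
    also have "\<dots> = (\<Sum>j\<le>n. \<Sum>i\<in>{i \<in> {..n}. i + j \<le> n}. smult (g $ i * f $ j) (q (n - i - j)))"
      by (rule sum.swap_restrict) auto
    also have "\<dots> = (\<Sum>j\<le>n. \<Sum>i\<le>n - j. smult (f $ j * g $ i) (q (n - j - i)))"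
      by (intro sum.cong refl) (auto simp: mult.commute add.commute)
    also have "\<dots> = M (L (q n))"
      by (simp add: f linear_operator_simps[OF M] g smult_sum_right)
    finally show "(L \<circ> M) (q n) = (M \<circ> L) (q n)" by simp
  qed
qed

section \<open>The operators \<open>Q\<close>, the derivative and the translations\<close>

lemma Q_operator_linear:
  assumes "graded p" "\<forall>n. w n \<noteq> 0"
  shows "linear_operator (Q_operator w p)"
  using Q_operator_spec[where w = w, OF assms(1) spec[OF assms(2)]] by (simp add: Q_operator_cond_def)

lemma Q_operator_lowers:
  assumes "graded p" "\<forall>n. w n \<noteq> 0"
  shows "Q_operator w p (smult (1 / w 0) (p 0)) = 0"
    and "Q_operator w p (smult (1 / w (Suc n)) (p (Suc n))) = smult (1 / w n) (p n)"
proof -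
  note Q = Q_operator_spec[where w = w, OF assms(1) spec[OF assms(2)], unfolded Q_operator_cond_def]
  show "Q_operator w p (smult (1 / w 0) (p 0)) = 0"
    using Q by (simp only: linear_operator_simps(4)[OF Q_operator_linear[OF assms]] smult_0_right)
  have "1 \<le> Suc n" by simp
  with Q show "Q_operator w p (smult (1 / w (Suc n)) (p (Suc n))) = smult (1 / w n) (p n)"
    by (simp only: diff_Suc_1)
qed

lemma delta_operator_Q_operator:
  assumes "graded p" "\<forall>n. w n \<noteq> 0"
  shows "delta_operator (Q_operator w p)"
  by (rule delta_operatorI_graded[where q = "\<lambda>n. smult (1 / w n) (p n)"])
    (use assms Q_operator_linear[of p w] Q_operator_lowers[of p w] in \<open>simp_all add: graded_smult\<close>)

abbreviation W_derivative :: "(nat \<Rightarrow> 'a::field) \<Rightarrow> 'a poly \<Rightarrow> 'a poly" where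
  "W_derivative w \<equiv> Q_operator w (monom 1)"

lemma graded_monom: "graded (monom (1 :: 'a::field))"
  by (simp add: graded_def degree_monom_eq)

lemma coeff_W_derivative:
  fixes w :: "nat \<Rightarrow> 'a::field"
  assumes w: "\<forall>n. w n \<noteq> 0"
  shows "w k * coeff (W_derivative w u) k = w (Suc k) * coeff u (Suc k)"
proof -
  let ?e = "\<lambda>n. smult (1 / w n) (monom 1 n) :: 'a poly"
  define S where "S u = Abs_poly (\<lambda>k. w (Suc k) / w k * coeff u (Suc k))" for u
  have S: "coeff (S u) k = w (Suc k) / w k * coeff u (Suc k)" for u k
    unfolding S_def by (subst coeff_Abs_poly[of "degree u"]) (simp_all add: coeff_eq_0)
  have "W_derivative w = S"
  proof (rule linear_operator_eqI[OF Q_operator_linear[OF graded_monom w] _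
        graded_smult[where w = w, OF graded_monom spec[OF w]]])
    show "linear_operator S"
      by (rule linear_operatorI) (simp_all add: poly_eq_iff S algebra_simps)
    fix n show "W_derivative w (?e n) = S (?e n)"
    proof (cases n)
      case 0
      show ?thesis unfolding 0 Q_operator_lowers(1)[OF graded_monom w]
        by (simp add: poly_eq_iff S)
    next
      case (Suc m)
      show ?thesis unfolding Suc Q_operator_lowers(2)[OF graded_monom w]
        by (auto simp: poly_eq_iff S w)
    qed
  qed
  thus ?thesis by (simp add: S w)
qed

text \<open>
  The defining formula of the translation exhibits it as the power series \<open>W(h D)\<close> in the derivative.
\<close>
lemma W_translation_commutes_W_derivative:
  fixes w :: "nat \<Rightarrow> 'a::field"
  assumes w: "\<forall>n. w n \<noteq> 0"
  shows "W_derivative w \<circ> W_translation w h = W_translation w h \<circ> W_derivative w"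
proof -
  let ?e = "\<lambda>n. smult (1 / w n) (monom 1 n)"
  have T: "linear_operator (W_translation w h)"
    "\<And>n. W_translation w h (?e n) = (\<Sum>k\<le>n. smult (h ^ (n - k) / w (n - k)) (?e k))"
    using W_translation_spec[where w = w, OF spec[OF w], of h] unfolding W_translation_cond_def by blast+
  have "W_translation w h (?e n) = (\<Sum>i\<le>n. smult (Abs_fps (\<lambda>i. h ^ i / w i) $ i) (?e (n - i)))" for n
    unfolding T(2)
    by (rule sum.reindex_bij_witness[of _ "\<lambda>i. n - i" "\<lambda>i. n - i"]) simp_all
  thus ?thesis
    by (intro commutes_iff_convolution[OF delta_operator_Q_operator[OF graded_monom w]
       T(1) graded_smult[where w = w, OF graded_monom spec[OF w]] Q_operator_lowers[OF graded_monom w],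
       THEN iffD2] exI allI)
qed

lemma nonzero_degree_eqI:
  assumes "coeff u n \<noteq> 0" "degree u \<le> n"
  shows "u \<noteq> 0 \<and> degree u = n"
  using assms le_degree[of u n] by auto

text \<open>
  The normalization \<open>w 0 = 1\<close> makes the term of degree \<open>n + 1\<close> cancel, and the next term has the
  nonzero coefficient \<open>1 / (w 1 * w n)\<close>.
\<close>
lemma delta_operator_W_translation_diff:
  fixes w :: "nat \<Rightarrow> 'a::field"
  assumes w0: "w 0 = 1" and w: "\<forall>n. w n \<noteq> 0"
  shows "delta_operator (\<lambda>u. W_translation w 1 u - u)"
proof -
  let ?e = "\<lambda>n. smult (1 / w n) (monom 1 n) :: 'a poly"
  have T: "linear_operator (W_translation w 1)"
    "\<And>n. W_translation w 1 (?e n) = (\<Sum>k\<le>n. smult (1 / w (n - k)) (?e k))"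
    using W_translation_spec[where w = w, OF spec[OF w], of 1] unfolding W_translation_cond_def power_one by blast+
  show ?thesis
  proof (rule delta_operatorI_graded[OF _ graded_smult[where w = w, OF graded_monom spec[OF w]]])
    show "linear_operator (\<lambda>u. W_translation w 1 u - u)"
      by (rule linear_operatorI) (simp_all add: linear_operator_simps[OF T(1)] smult_diff_right)
    show "W_translation w 1 (?e 0) - ?e 0 = 0"
      by (simp only: T(2)) (simp add: w0)
    show "graded (\<lambda>n. W_translation w 1 (?e (Suc n)) - ?e (Suc n))"
      unfolding graded_def
    proof
      fix n
      let ?s = "\<Sum>k\<le>n. smult (1 / w (Suc n - k)) (?e k)"
      have eq: "W_translation w 1 (?e (Suc n)) - ?e (Suc n) = ?s"
        by (simp only: T(2)) (simp add: w0)
      have c: "coeff ?s m = (if m \<le> n then 1 / w (Suc n - m) / w m else 0)" for m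
        by (simp add: coeff_sum if_distrib sum.delta cong: if_cong)
      have "coeff ?s n \<noteq> 0" unfolding c by (simp add: w)
      moreover have "degree ?s \<le> n" by (rule degree_le) (simp only: c, simp)
      ultimately show "W_translation w 1 (?e (Suc n)) - ?e (Suc n) \<noteq> 0 \<and>
          degree (W_translation w 1 (?e (Suc n)) - ?e (Suc n)) = n"
        unfolding eq by (rule nonzero_degree_eqI)
    qed
  qed
qed

text \<open>
  The forward direction goes through \<open>T_1 - I\<close> instead of comparing coefficients of the powers of \<open>h\<close>
  in \<open>T_h\<close>, since over a finite field different polynomials in \<open>h\<close> may agree for all \<open>h\<close>.
\<close>
lemma W_Sheffer_iff_commutes_W_derivative:
  fixes w :: "nat \<Rightarrow> 'a::field"
  assumes w0: "w 0 = 1" and w: "\<forall>n. w n \<noteq> 0" and p: "graded p"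
  shows "W_Sheffer w p \<longleftrightarrow> Q_operator w p \<circ> W_derivative w = W_derivative w \<circ> Q_operator w p"
proof -
  let ?Q = "Q_operator w p" and ?D = "W_derivative w" and ?T = "W_translation w"
  have Q: "linear_operator ?Q" and D: "linear_operator ?D"
    by (rule Q_operator_linear[OF p w] Q_operator_linear[OF graded_monom w])+
  have T: "linear_operator (?T h)" for h
    using W_translation_spec[where w = w, OF spec[OF w], of h] by (simp add: W_translation_cond_def)
  have DT: "?D (?T h u) = ?T h (?D u)" for h u
    using fun_cong[OF W_translation_commutes_W_derivative[OF w, of h], of u] by simp
  show ?thesis
  proof
    assume "W_Sheffer w p"
    hence QT: "?Q (?T 1 u) = ?T 1 (?Q u)" for u
      unfolding W_Sheffer_def by (metis comp_apply)
    show "?Q \<circ> ?D = ?D \<circ> ?Q"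
      by (rule centralizer_delta_operator_commutative[OF
            delta_operator_W_translation_diff[OF w0 w] Q D])
        (simp_all add: fun_eq_iff linear_operator_simps[OF Q] linear_operator_simps[OF D] QT DT)
  next
    assume QD: "?Q \<circ> ?D = ?D \<circ> ?Q"
    have "?Q \<circ> ?T h = ?T h \<circ> ?Q" for h
      by (rule centralizer_delta_operator_commutative[OF
            delta_operator_Q_operator[OF graded_monom w] Q T QD[symmetric]
            W_translation_commutes_W_derivative[OF w]])
    thus "W_Sheffer w p" using p by (simp add: W_Sheffer_def)
  qed
qed

section \<open>Riordan arrays and Sheffer sequences\<close>

text \<open>
  The division is exact because the column series has valuation \<open>k\<close>, which grows with \<open>k\<close>; so the
  quotient can be replaced by a multiplicative equation.
\<close>
lemma W_Riordan_iff_mult: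
  fixes w :: "nat \<Rightarrow> 'a::field"
  assumes w: "\<forall>n. w n \<noteq> 0" and A: "A \<in> lower_triangular_group"
  shows "A \<in> W_Riordan w \<longleftrightarrow> (\<exists>f. \<forall>k.
    fps_const (w (Suc k)) * column_series w A (Suc k) = f * (fps_const (w k) * column_series w A k))"
proof -
  define B where "B k = fps_const (w k) * column_series w A k" for k
  have nz: "B k \<noteq> 0" for k
  proof -
    have "B k $ k \<noteq> 0"
      using A w by (simp add: B_def column_series_def lower_triangular_group_def)
    thus ?thesis by auto
  qed
  have sub: "subdegree (B k) = k" for k
    using nz[of k] subdegree_column_series[where w = w, OF A spec[OF w]] by (auto simp: B_def w)
  have "B k dvd B (Suc k)" for k
    using fps_dvd_iff[OF nz[of k] nz[of "Suc k"]] sub by simp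
  hence "B (Suc k) div B k = f \<longleftrightarrow> B (Suc k) = f * B k" for k f
    using nz[of k] by (metis dvd_div_mult_self nonzero_mult_div_cancel_right)
  thus ?thesis using A by (simp add: W_Riordan_def B_def)
qed

theorem theorem2p4:
  fixes w :: "nat \<Rightarrow> 'a::field"
    and p :: "nat \<Rightarrow> 'a poly"
    and A :: "nat \<Rightarrow> nat \<Rightarrow> 'a"
  assumes "w 0 = 1"
    and "\<And>n. w n \<noteq> 0"
    and "graded p"
    and "A \<in> lower_triangular_group"
    and "\<And>n. p n = (\<Sum>k\<le>n. monom (A n k) k)"
  shows "W_Sheffer w p \<longleftrightarrow> A \<in> W_Riordan w"
proof -
  have w: "\<forall>n. w n \<noteq> 0" using assms(2) by blast
  note p = assms(3)
  let ?D = "W_derivative w" and ?q = "\<lambda>n. smult (1 / w n) (p n)"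
  let ?B = "\<lambda>k. fps_const (w k) * column_series w A k"
  have D: "linear_operator ?D" by (rule Q_operator_linear[OF graded_monom w])
  have coeff_p: "coeff (p n) k = A n k" for n k
    using assms(4) by (simp add: assms(5) coeff_sum lower_triangular_group_def sum.delta
        if_distrib not_le cong: if_cong)
  have B_nth: "?B k $ n = w k * (A n k / w n)" for k n
    by (simp add: column_series_def)
  \<comment> \<open>The \<open>k\<close>-th coefficient is compared after multiplication by \<open>w k\<close>, which turns the
    coefficients of \<open>p n / w n\<close> into those of \<open>w k\<close> times the \<open>k\<close>-th column series.\<close>
  have coefficientwise: "?D (?q n) = (\<Sum>i\<le>n. smult (f $ i) (?q (n - i))) \<longleftrightarrow>
      (\<forall>k. ?B (Suc k) $ n = (f * ?B k) $ n)" for f n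
  proof -
    have "w k * coeff (?D (?q n)) k = ?B (Suc k) $ n" for k
      unfolding B_nth by (simp add: coeff_W_derivative[OF w] coeff_p)
    moreover have "w k * coeff (\<Sum>i\<le>n. smult (f $ i) (?q (n - i))) k = (f * ?B k) $ n" for k
      unfolding fps_mult_nth[of f] B_nth
      by (simp add: coeff_sum coeff_p atLeast0AtMost sum_distrib_left mult_ac)
    moreover have "u = v \<longleftrightarrow> (\<forall>k. w k * coeff u k = w k * coeff v k)" for u v
      using w by (simp add: poly_eq_iff)
    ultimately show ?thesis by (simp only:)
  qed
  have "W_Sheffer w p \<longleftrightarrow> (\<exists>f :: 'a fps. \<forall>n. ?D (?q n) = (\<Sum>i\<le>n. smult (f $ i) (?q (n - i))))"
    unfolding W_Sheffer_iff_commutes_W_derivative[OF assms(1) w p]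
    by (rule commutes_iff_convolution[OF delta_operator_Q_operator[OF p w] D
          graded_smult[where w = w, OF p spec[OF w]] Q_operator_lowers[OF p w]])
  also have "\<dots> \<longleftrightarrow> (\<exists>f. \<forall>k. ?B (Suc k) = f * ?B k)"
    by (simp only: coefficientwise fps_eq_iff) blast
  also have "\<dots> \<longleftrightarrow> A \<in> W_Riordan w"
    by (rule W_Riordan_iff_mult[OF w assms(4), symmetric])
  finally show ?thesis .
qed

end
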